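(* Let $\omega$ be a non-degenerate skew-symmetric bilinear form on $\mathbb{R}^{2n}$, and let $\nabla,\nabla'$ be two affine structures on $\mathbb{R}^{2n}$, both compatible with $\omega$, satisfying $\nabla_x\nabla'_y=\nabla_y\nabla'_x$ for all $x,y\in\mathbb{R}^{2n}$. Let $\mathfrak{n}_{\nabla,\nabla'}$ be the Lie algebra $\mathbb{R}^{2n}\oplus\mathbb{R}^{2n}$ with bracket $$[(x,x'),(y,y')]=\bigl(\nabla'_yx'-\nabla'_xy',\ \nabla_xy'-\nabla_yx'\bigr).$$ Then the $2$-forms $\omega_1,\omega_2,\omega_3$ on $\mathfrak{n}_{\nabla,\nabla'}$ given by $$\omega_1((x,x'),(y,y'))=\omega(x,y)+\omega(x',y'),$$ $$\omega_2((x,x'),(y,y'))=-\omega(x,y')+\omega(y,x'),$$ $$\omega_3((x,x'),(y,y'))=\omega(x,y)-\omega(x',y')$$ are closed on $\mathfrak{n}_{\nabla,\nabla'}$.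
   Context: An affine structure on $\mathbb{R}^m$ is a bilinear map $\nabla:\mathbb{R}^m\times\mathbb{R}^m\to\mathbb{R}^m$, $(x,y)\mapsto\nabla_xy$, such that $\nabla_xy=\nabla_yx$ and $\nabla_x\nabla_y=\nabla_y\nabla_x$ (as endomorphisms of $\mathbb{R}^m$) for all $x,y\in\mathbb{R}^m$. It is compatible with a non-degenerate skew-symmetric bilinear form $\omega$ on $\mathbb{R}^m$ if $\omega(\nabla_xy,z)=\omega(\nabla_xz,y)$ for all $x,y,z\in\mathbb{R}^m$. Under the stated hypotheses the given bracket is indeed a Lie bracket. A skew-symmetric bilinear form $\sigma$ on a Lie algebra $\mathfrak{g}$ is closed if $d\sigma=0$, where $d\sigma(u,v,w)=\sigma(u,[v,w])+\sigma(v,[w,u])+\sigma(w,[u,v])$ for $u,v,w\in\mathfrak{g}$. *)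

theory Defs
  imports "HOL-Analysis.Analysis"
begin

definition two_form :: "('a::real_vector \<Rightarrow> 'a \<Rightarrow> real) \<Rightarrow> bool" where
  "two_form \<sigma> \<longleftrightarrow> bilinear \<sigma> \<and> (\<forall>u v. \<sigma> u v = - \<sigma> v u)"

definition nondegenerate :: "('a::real_vector \<Rightarrow> 'a \<Rightarrow> real) \<Rightarrow> bool" where
  "nondegenerate \<sigma> \<longleftrightarrow> (\<forall>u. (\<forall>v. \<sigma> u v = 0) \<longrightarrow> u = 0)"

definition lie_bracket :: "('a::real_vector \<Rightarrow> 'a \<Rightarrow> 'a) \<Rightarrow> bool" where
  "lie_bracket br \<longleftrightarrow> bilinear br \<and> (\<forall>u. br u u = 0) \<and>
     (\<forall>u v w. br u (br v w) + br v (br w u) + br w (br u v) = 0)"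

definition form_differential ::
    "('a::real_vector \<Rightarrow> 'a \<Rightarrow> 'a) \<Rightarrow> ('a \<Rightarrow> 'a \<Rightarrow> real) \<Rightarrow> 'a \<Rightarrow> 'a \<Rightarrow> 'a \<Rightarrow> real" where
  "form_differential br \<sigma> u v w = \<sigma> u (br v w) + \<sigma> v (br w u) + \<sigma> w (br u v)"

definition closed_two_form ::
    "('a::real_vector \<Rightarrow> 'a \<Rightarrow> 'a) \<Rightarrow> ('a \<Rightarrow> 'a \<Rightarrow> real) \<Rightarrow> bool" where
  "closed_two_form br \<sigma> \<longleftrightarrow> two_form \<sigma> \<and> (\<forall>u v w. form_differential br \<sigma> u v w = 0)"

text \<open>An affine structure is a map \<open>D\<close> with \<open>D x y\<close> standing for \<open>\<nabla>\<^sub>x y\<close>; thus \<open>D x\<close> is the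
  endomorphism \<open>\<nabla>\<^sub>x\<close>.\<close>

definition affine_structure :: "('a::real_vector \<Rightarrow> 'a \<Rightarrow> 'a) \<Rightarrow> bool" where
  "affine_structure D \<longleftrightarrow> bilinear D \<and> (\<forall>x y. D x y = D y x) \<and> (\<forall>x y. D x \<circ> D y = D y \<circ> D x)"

definition compatible ::
    "('a::real_vector \<Rightarrow> 'a \<Rightarrow> 'a) \<Rightarrow> ('a \<Rightarrow> 'a \<Rightarrow> real) \<Rightarrow> bool" where
  "compatible D \<omega> \<longleftrightarrow> (\<forall>x y z. \<omega> (D x y) z = \<omega> (D x z) y)"

definition pair_bracket ::
    "('a::real_vector \<Rightarrow> 'a \<Rightarrow> 'a) \<Rightarrow> ('a \<Rightarrow> 'a \<Rightarrow> 'a) \<Rightarrow> 'a \<times> 'a \<Rightarrow> 'a \<times> 'a \<Rightarrow> 'a \<times> 'a" where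
  "pair_bracket D D' = (\<lambda>(x, x') (y, y'). (D' y x' - D' x y', D x y' - D y x'))"

definition omega1 :: "('a \<Rightarrow> 'a \<Rightarrow> real) \<Rightarrow> 'a \<times> 'a \<Rightarrow> 'a \<times> 'a \<Rightarrow> real" where
  "omega1 \<omega> = (\<lambda>(x, x') (y, y'). \<omega> x y + \<omega> x' y')"

definition omega2 :: "('a \<Rightarrow> 'a \<Rightarrow> real) \<Rightarrow> 'a \<times> 'a \<Rightarrow> 'a \<times> 'a \<Rightarrow> real" where
  "omega2 \<omega> = (\<lambda>(x, x') (y, y'). - \<omega> x y' + \<omega> y x')"

definition omega3 :: "('a \<Rightarrow> 'a \<Rightarrow> real) \<Rightarrow> 'a \<times> 'a \<Rightarrow> 'a \<times> 'a \<Rightarrow> real" where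
  "omega3 \<omega> = (\<lambda>(x, x') (y, y'). \<omega> x y - \<omega> x' y')"

end

theory Submission
  imports Defs
begin

text \<open>Write \<open>T(x, y, z) = \<omega>(\<nabla>\<^sub>x y, z)\<close> and \<open>T'(x, y, z) = \<omega>(\<nabla>'\<^sub>x y, z)\<close>.  Symmetry of the affine
  structures together with compatibility makes \<open>T\<close> and \<open>T'\<close> totally symmetric.  Evaluating
  \<open>\<omega>\<^sub>1\<close>, \<open>\<omega>\<^sub>2\<close> or \<open>\<omega>\<^sub>3\<close> on \<open>u = (x, x')\<close> and \<open>[v, w]\<close> with \<open>v = (y, y')\<close>, \<open>w = (z, z')\<close> gives a
  signed combination of differences such as \<open>T'(x, y, z') - T'(x, z, y')\<close> or
  \<open>T(x', y', z) - T(x', z', y)\<close>, and total symmetry makes the cyclic sum of each of them vanish.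
  This is closedness.

  In the Jacobi identity, the components of \<open>[u, [v, w]]\<close> consist in the same way of differences
  such as \<open>\<nabla>\<^sub>x \<nabla>\<^sub>y z' - \<nabla>\<^sub>x \<nabla>\<^sub>z y'\<close>, with primes distributed over the two operators.  Their cyclic sums
  vanish as soon as each of \<open>\<nabla>\<^sub>x \<nabla>\<^sub>y\<close>, \<open>\<nabla>'\<^sub>x \<nabla>'\<^sub>y\<close>, \<open>\<nabla>\<^sub>x \<nabla>'\<^sub>y\<close> and \<open>\<nabla>'\<^sub>x \<nabla>\<^sub>y\<close> is symmetric in \<open>x\<close> and
  \<open>y\<close>.  The first two symmetries belong to the affine structures and the third is the mixed
  hypothesis.  The fourth is its adjoint: compatibility says that every \<open>\<nabla>\<^sub>x\<close> and \<open>\<nabla>'\<^sub>x\<close> is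
  skew-adjoint for \<open>\<omega>\<close>, so that \<open>\<nabla>'\<^sub>y \<nabla>\<^sub>x\<close> is the adjoint of \<open>\<nabla>\<^sub>x \<nabla>'\<^sub>y\<close>, and \<open>\<omega>\<close> is non-degenerate.\<close>

lemma bilinearI:
  assumes "\<And>x y z. f (x + y) z = f x z + f y z" "\<And>c x z. f (c *\<^sub>R x) z = c *\<^sub>R f x z"
    and "\<And>x y z. f x (y + z) = f x y + f x z" "\<And>c x z. f x (c *\<^sub>R z) = c *\<^sub>R f x z"
  shows "bilinear f"
  unfolding bilinear_def by (intro conjI allI linearI) (simp_all add: assms)

lemmas bilinear_simps =
  bilinear_ladd bilinear_radd bilinear_lmul bilinear_rmul bilinear_lsub bilinear_rsub

lemma two_form_swap:
  assumes "two_form \<omega>"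
  shows "\<omega> x y = - \<omega> y x"
  using assms unfolding two_form_def by blast

lemma two_form_omega1:
  assumes "two_form \<omega>"
  shows "two_form (omega1 \<omega>)"
proof -
  have b: "bilinear \<omega>"
    using assms by (simp add: two_form_def)
  have "bilinear (omega1 \<omega>)"
    by (rule bilinearI) (auto simp: omega1_def bilinear_simps[OF b] algebra_simps)
  moreover have "omega1 \<omega> u v = - omega1 \<omega> v u" for u v
    using two_form_swap[OF assms, of "fst u" "fst v"] two_form_swap[OF assms, of "snd u" "snd v"]
    by (simp add: omega1_def split_beta)
  ultimately show ?thesis
    unfolding two_form_def by blast
qed

lemma two_form_omega2:
  assumes "two_form \<omega>"
  shows "two_form (omega2 \<omega>)"
proof -
  have b: "bilinear \<omega>"
    using assms by (simp add: two_form_def)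
  have "bilinear (omega2 \<omega>)"
    by (rule bilinearI) (auto simp: omega2_def bilinear_simps[OF b] algebra_simps)
  moreover have "omega2 \<omega> u v = - omega2 \<omega> v u" for u v
    by (simp add: omega2_def split_beta)
  ultimately show ?thesis
    unfolding two_form_def by blast
qed

lemma two_form_omega3:
  assumes "two_form \<omega>"
  shows "two_form (omega3 \<omega>)"
proof -
  have b: "bilinear \<omega>"
    using assms by (simp add: two_form_def)
  have "bilinear (omega3 \<omega>)"
    by (rule bilinearI) (auto simp: omega3_def bilinear_simps[OF b] algebra_simps)
  moreover have "omega3 \<omega> u v = - omega3 \<omega> v u" for u v
    using two_form_swap[OF assms, of "fst u" "fst v"] two_form_swap[OF assms, of "snd u" "snd v"]
    by (simp add: omega3_def split_beta)
  ultimately show ?thesis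
    unfolding two_form_def by blast
qed

lemma compatible_skew_adjoint:
  assumes "two_form \<omega>" "compatible D \<omega>"
  shows "\<omega> (D x y) z = - \<omega> y (D x z)"
  using assms two_form_swap[OF assms(1), of y "D x z"] unfolding compatible_def by simp

lemma mixed_symmetry_adjoint:
  assumes form: "two_form \<omega>" and nondeg: "nondegenerate \<omega>"
    and comp: "compatible D \<omega>" and comp': "compatible D' \<omega>"
    and mixed: "\<And>x y z. D x (D' y z) = D y (D' x z)"
  shows "D' x (D y z) = D' y (D x z)"
proof -
  have b: "bilinear \<omega>"
    using form by (simp add: two_form_def)
  have adj: "\<omega> (D' a (D b c)) v = \<omega> c (D b (D' a v))" for a b c v
    by (simp add: compatible_skew_adjoint[OF form comp'] compatible_skew_adjoint[OF form comp])
  have "\<omega> (D' x (D y z) - D' y (D x z)) v = 0" for v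
    by (simp add: bilinear_lsub[OF b] adj mixed[of y x])
  then have "D' x (D y z) - D' y (D x z) = 0"
    using nondeg unfolding nondegenerate_def by blast
  then show ?thesis by simp
qed

text \<open>The four hypotheses on iterated maps say that \<open>D x \<circ> D y\<close>, \<open>D' x \<circ> D' y\<close>, \<open>D x \<circ> D' y\<close> and
  \<open>D' x \<circ> D y\<close> are all symmetric in \<open>x\<close> and \<open>y\<close>.\<close>

lemma lie_bracket_pair_bracket:
  assumes b: "bilinear D" and b': "bilinear D'"
    and sym: "\<And>x y. D x y = D y x" and sym': "\<And>x y. D' x y = D' y x"
    and comm: "\<And>x y z. D x (D y z) = D y (D x z)"
    and comm': "\<And>x y z. D' x (D' y z) = D' y (D' x z)"
    and mixed: "\<And>x y z. D x (D' y z) = D y (D' x z)"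
    and mixed': "\<And>x y z. D' x (D y z) = D' y (D x z)"
  shows "lie_bracket (pair_bracket D D')"
proof -
  have "bilinear (pair_bracket D D')"
    by (rule bilinearI)
      (auto simp: pair_bracket_def bilinear_simps[OF b] bilinear_simps[OF b'] algebra_simps)
  moreover have "pair_bracket D D' u u = 0" for u
    by (simp add: pair_bracket_def split_beta zero_prod_def)
  moreover have "pair_bracket D D' u (pair_bracket D D' v w)
      + pair_bracket D D' v (pair_bracket D D' w u)
      + pair_bracket D D' w (pair_bracket D D' u v) = 0" for u v w
  proof -
    obtain x x' y y' z z' where uvw: "u = (x, x')" "v = (y, y')" "w = (z, z')"
      by (metis surj_pair)
    \<comment> \<open>Move a component of the inner bracket from the lower slot into the argument, so that
      only compositions of operators remain.\<close>
    have move: "D (D' p q - D' r s) t = D t (D' p q) - D t (D' r s)"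
      "D' (D' p q - D' r s) t = D' t (D' p q) - D' t (D' r s)" for p q r s t
      by (simp_all add: sym[of _ t] sym'[of _ t] bilinear_simps[OF b] bilinear_simps[OF b'])
    have cyc': "D' x' (D' z y') - D' x' (D' y z') + (D' y' (D' x z') - D' y' (D' z x'))
        + (D' z' (D' y x') - D' z' (D' x y')) = 0"
      using comm'[of x' z' y] comm'[of y' x' z] comm'[of z' y' x] by (simp add: sym')
    have cycm': "D' x (D y z') - D' x (D z y') + (D' y (D z x') - D' y (D x z'))
        + (D' z (D x y') - D' z (D y x')) = 0"
      using mixed'[of x y z'] mixed'[of x z y'] mixed'[of y z x'] by simp
    have cyc: "D x (D y z') - D x (D z y') + (D y (D z x') - D y (D x z'))
        + (D z (D x y') - D z (D y x')) = 0"
      using comm[of x y z'] comm[of x z y'] comm[of y z x'] by simp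
    have cycm: "D x' (D' z y') - D x' (D' y z') + (D y' (D' x z') - D y' (D' z x'))
        + (D z' (D' y x') - D z' (D' x y')) = 0"
      using mixed[of x' z' y] mixed[of y' x' z] mixed[of z' y' x] by (simp add: sym')
    show ?thesis
      using arg_cong2[where f = "(-)", OF cyc' cycm'] arg_cong2[where f = "(-)", OF cyc cycm]
      by (simp add: uvw pair_bracket_def move bilinear_rsub[OF b] bilinear_rsub[OF b']
          zero_prod_def algebra_simps)
  qed
  ultimately show ?thesis
    unfolding lie_bracket_def by blast
qed

text \<open>Every value of the differentials of \<open>\<omega>\<^sub>1\<close>, \<open>\<omega>\<^sub>2\<close> and \<open>\<omega>\<^sub>3\<close> is a signed combination of such cyclic
  sums, for \<open>D\<close> or \<open>D'\<close>.  Closedness needs only the symmetry of \<open>D\<close> and its compatibility with \<open>\<omega>\<close>;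
  the commutation rules for \<open>D x \<circ> D y\<close> play no role.\<close>

lemma cyclic_sum_cubic_form:
  assumes form: "two_form \<omega>" and sym: "\<And>x y. D x y = D y x" and comp: "compatible D \<omega>"
  shows "\<omega> x (D y z') - \<omega> x (D z y') + (\<omega> y (D z x') - \<omega> y (D x z'))
    + (\<omega> z (D x y') - \<omega> z (D y x')) = 0"
proof -
  have total_sym: "\<omega> p (D q r) = \<omega> q (D p r)" for p q r
    using compatible_skew_adjoint[OF form comp, of r p q]
      compatible_skew_adjoint[OF form comp, of r q p] two_form_swap[OF form, of q "D r p"]
    by (simp add: sym)
  then show ?thesis
    by (simp add: total_sym[of y x] total_sym[of z x] total_sym[of z y])
qed

lemma closed_omegas:
  assumes form: "two_form \<omega>"
    and sym: "\<And>x y. D x y = D y x" and sym': "\<And>x y. D' x y = D' y x"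
    and comp: "compatible D \<omega>" and comp': "compatible D' \<omega>"
  shows "closed_two_form (pair_bracket D D') (omega1 \<omega>)"
    and "closed_two_form (pair_bracket D D') (omega2 \<omega>)"
    and "closed_two_form (pair_bracket D D') (omega3 \<omega>)"
proof -
  have b: "bilinear \<omega>"
    using form by (simp add: two_form_def)
  note cyc = cyclic_sum_cubic_form[OF form sym comp]
  note cyc' = cyclic_sum_cubic_form[OF form sym' comp']
  have d: "form_differential (pair_bracket D D') (omega1 \<omega>) u v w = 0 \<and>
      form_differential (pair_bracket D D') (omega2 \<omega>) u v w = 0 \<and>
      form_differential (pair_bracket D D') (omega3 \<omega>) u v w = 0" for u v w
  proof -
    obtain x x' y y' z z' where uvw: "u = (x, x')" "v = (y, y')" "w = (z, z')"
      by (metis surj_pair)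
    \<comment> \<open>In the second and fourth sums the primed and unprimed vectors exchange roles.\<close>
    have c1: "\<omega> x (D' y z') - \<omega> x (D' z y') + (\<omega> y (D' z x') - \<omega> y (D' x z'))
        + (\<omega> z (D' x y') - \<omega> z (D' y x')) = 0"
      by (rule cyc')
    have c2: "\<omega> x' (D y z') - \<omega> x' (D z y') + (\<omega> y' (D z x') - \<omega> y' (D x z'))
        + (\<omega> z' (D x y') - \<omega> z' (D y x')) = 0"
      using cyc[where x = x' and y = y' and z = z' and x' = x and y' = y and z' = z]
      by (simp add: sym)
    have c3: "\<omega> x (D y z') - \<omega> x (D z y') + (\<omega> y (D z x') - \<omega> y (D x z'))
        + (\<omega> z (D x y') - \<omega> z (D y x')) = 0"
      by (rule cyc)
    have c4: "\<omega> x' (D' y z') - \<omega> x' (D' z y') + (\<omega> y' (D' z x') - \<omega> y' (D' x z'))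
        + (\<omega> z' (D' x y') - \<omega> z' (D' y x')) = 0"
      using cyc'[where x = x' and y = y' and z = z' and x' = x and y' = y and z' = z]
      by (simp add: sym')
    have sw: "\<omega> (D' p q - D' r s) t = \<omega> t (D' r s) - \<omega> t (D' p q)" for p q r s t
      using two_form_swap[OF form, of "D' p q - D' r s" t] by (simp add: bilinear_rsub[OF b])
    show ?thesis
      using c1 c2 c3 c4
      by (simp add: uvw form_differential_def pair_bracket_def omega1_def omega2_def omega3_def
          sw bilinear_rsub[OF b])
  qed
  then show "closed_two_form (pair_bracket D D') (omega1 \<omega>)"
    "closed_two_form (pair_bracket D D') (omega2 \<omega>)"
    "closed_two_form (pair_bracket D D') (omega3 \<omega>)"
    using two_form_omega1[OF form] two_form_omega2[OF form] two_form_omega3[OF form]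
    unfolding closed_two_form_def by blast+
qed

theorem proposition3p1:
  fixes n :: nat
    and \<omega> :: "real ^ 'm \<Rightarrow> real ^ 'm \<Rightarrow> real"
    and D D' :: "real ^ 'm \<Rightarrow> real ^ 'm \<Rightarrow> real ^ 'm"
  assumes dim: "CARD('m) = 2 * n"
    and form: "two_form \<omega>" and nondeg: "nondegenerate \<omega>"
    and aff: "affine_structure D" and aff': "affine_structure D'"
    and comp: "compatible D \<omega>" and comp': "compatible D' \<omega>"
    and mixed: "\<forall>x y. D x \<circ> D' y = D y \<circ> D' x"
  shows "lie_bracket (pair_bracket D D') \<and>
    closed_two_form (pair_bracket D D') (omega1 \<omega>) \<and>
    closed_two_form (pair_bracket D D') (omega2 \<omega>) \<and>
    closed_two_form (pair_bracket D D') (omega3 \<omega>)"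
proof -
  have b: "bilinear D" "bilinear D'"
    and sym: "\<And>x y. D x y = D y x" and sym': "\<And>x y. D' x y = D' y x"
    using aff aff' unfolding affine_structure_def by blast+
  have comm: "D x (D y z) = D y (D x z)" and comm': "D' x (D' y z) = D' y (D' x z)"
    and mix: "D x (D' y z) = D y (D' x z)" for x y z
    using aff aff' mixed unfolding affine_structure_def by (metis comp_apply)+
  note mix' = mixed_symmetry_adjoint[OF form nondeg comp comp' mix]
  show ?thesis
    using lie_bracket_pair_bracket[OF b sym sym' comm comm' mix mix']
      closed_omegas[OF form sym sym' comp comp'] by blast
qed

end
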